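(* Let $(X,\tau,\le)$ be a separable linearly ordered topological space, let $\mu$ be a probability measure on the Borel $\sigma$-algebra of $(X,\tau)$, let $F$ be its cumulative distribution function, let $F_-(x)=\mu(\{y\in X:y<x\})$ for $x \in X$, and let $G$ be the pseudo-inverse of $F$. Let $x\in X$ and $r\in[0,1]$. In items (1), (2), (4), (5) it is assumed that $G$ is defined at $r$. Then: (1) $F(x)<r$ if and only if $G(r)>x$. (2) If $F_-(x)<r$, then $x\le G(r)$. (3) If $F_-(x)<r\le F(x)$, then $G$ is defined at $r$ and $G(r)=x$. (4) If $r<F_-(x)$, then $G(r)<x$. (5) If $r=F_-(x)$, then $G(r)\le x$.
   Context: A linearly ordered topological space (LOTS) is a triple $(X,\tau,\le)$ where $\le$ is a linear order on $X$ and $\tau$ is the order topology, i.e. the topology with subbasis $\{\{x\in X:x<a\}:a\in X\}\cup\{\{x\in X:x>a\}:a\in X\}$. Separable means having a countable $\tau$-dense subset. The cumulative distribution function of $\mu$ is $F:X\to[0,1]$, $F(x)=\mu(\{y\in X:y\le x\})$. The pseudo-inverse of $F$ is the partial function $G$ from $[0,1]$ to $X$ given by $G(r)=\inf\{y\in X:F(y)\ge r\}$, defined exactly at those $r\in[0,1]$ for which this infimum (greatest lower bound in $X$) exists. *)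

theory Defs
  imports "HOL-Probability.Probability" "HOL-Library.Lub_Glb"
begin

text \<open>The library's \<open>cdf\<close> covers only measures on the real line; here the underlying space is an
  arbitrary linearly ordered topological space.\<close>

definition lots_cdf :: "'a::linorder_topology measure \<Rightarrow> 'a \<Rightarrow> real"
  where "lots_cdf \<mu> x = measure \<mu> {y. y \<le> x}"

definition lots_cdf_left :: "'a::linorder_topology measure \<Rightarrow> 'a \<Rightarrow> real"
  where "lots_cdf_left \<mu> x = measure \<mu> {y. y < x}"

text \<open>The infimum is the order-theoretic greatest lower bound in the whole space, so for an empty set
  it exists only if the space has a greatest element. It is unique by \<open>isGlb_unique\<close>, which makes
  the description below well defined.\<close>

definition pseudo_inverse :: "'a::linorder_topology measure \<Rightarrow> real \<Rightarrow> 'a option"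
  where "pseudo_inverse \<mu> r =
    (if r \<in> {0..1} \<and> (\<exists>g. isGlb UNIV {y. lots_cdf \<mu> y \<ge> r} g)
     then Some (THE g. isGlb UNIV {y. lots_cdf \<mu> y \<ge> r} g)
     else None)"

end

theory Submission
  imports Defs
begin

text \<open>For \<open>A = {y. r \<le> F y}\<close>, an up-set whose greatest lower bound is \<open>G r\<close>, items (2), (3), (5) and one
  half of (1) only use that \<open>F y \<le> F' x \<le> F x\<close> for \<open>y < x\<close>. The remaining two claims need
  one-sided continuity of \<open>F\<close>, and this is where separability enters: continuity of a measure
  concerns countable families, and a countable dense set lets a ray be written as the union of
  countably many smaller rays. In a chain of measurable sets, one member of the countable family
  must then already have measure close to that of the union (\<open>measure_countable_chain_greater\<close>).

  Continuity from the left (\<open>cdf_approximates_left_cdf\<close>) gives (4): some \<open>y < x\<close> lies in \<open>A\<close>.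
  Continuity from the right, at points without an immediate successor
  (\<open>cdf_approximates_from_right\<close>), shows that \<open>A\<close> contains its greatest lower bound
  (\<open>isGlb_cdf_superlevel_mem\<close>), which gives the other half of (1).\<close>

section \<open>Countable chains of measurable sets\<close>

text \<open>The members of an enumeration can be replaced by the unions of its initial segments, which
  increase; in a chain such a finite union is again a member, so its measure obeys the same bound.\<close>

lemma (in finite_measure) measure_countable_chain_greater:
  assumes "countable \<C>" and chain: "subset.chain UNIV \<C>" and sets: "\<C> \<subseteq> sets M"
    and "0 \<le> r" and gr: "r < measure M (\<Union>\<C>)"
  shows "\<exists>S\<in>\<C>. r < measure M S"
proof (rule ccontr)
  assume "\<not> ?thesis"
  then have le: "measure M S \<le> r" if "S \<in> \<C>" for S
    using that by (meson not_less)
  have ne: "\<C> \<noteq> {}"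
    using \<open>0 \<le> r\<close> gr by auto
  define A where "A n = \<Union>(from_nat_into \<C> ` {..n})" for n
  have A: "A n \<in> \<C>" for n
  proof -
    have sub: "from_nat_into \<C> ` {..n} \<subseteq> \<C>"
      using from_nat_into[OF ne] by auto
    then have "subset.chain UNIV (from_nat_into \<C> ` {..n})"
      using chain by (auto simp: subset.chain_def)
    then have "A n \<in> from_nat_into \<C> ` {..n}"
      unfolding A_def by (intro Union_in_chain) auto
    then show ?thesis
      using sub by blast
  qed
  have "incseq A"
    unfolding A_def by (intro monoI Union_mono image_mono) simp
  moreover have "range A \<subseteq> sets M"
    using A sets by blast
  ultimately have "(\<lambda>n. measure M (A n)) \<longlonglongrightarrow> measure M (\<Union>n. A n)"
    by (intro finite_Lim_measure_incseq)
  moreover have "(\<Union>n. A n) = \<Union>\<C>"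
    unfolding A_def using range_from_nat_into[OF ne \<open>countable \<C>\<close>] by blast
  ultimately have "measure M (\<Union>\<C>) \<le> r"
    using le[OF A] by (auto intro: LIMSEQ_le_const2)
  then show False
    using gr by simp
qed

section \<open>Rays in a separable linearly ordered space\<close>

lemma separable_space_countable_dense:
  assumes "separable_space (euclidean :: 'a::topological_space topology)"
  obtains D :: "'a::topological_space set" where "countable D" "\<And>U. open U \<Longrightarrow> U \<noteq> {} \<Longrightarrow> D \<inter> U \<noteq> {}"
proof -
  obtain D :: "'a set" where "countable D" "closure D = UNIV"
    using assms by (auto simp: separable_space_def)
  moreover have "D \<inter> U \<noteq> {}" if "open U" "U \<noteq> {}" for U
    using that \<open>closure D = UNIV\<close> open_Int_closure_eq_empty[of U D] by auto
  ultimately show thesis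
    using that by blast
qed

text \<open>Either \<open>x\<close> has an immediate predecessor, whose ray alone is \<open>{..<x}\<close>, or every interval
  \<open>{y<..<x}\<close> with \<open>y < x\<close> meets a countable dense set.\<close>

lemma lessThan_eq_countable_Union_atMost:
  fixes x :: "'a::linorder_topology"
  assumes "separable_space (euclidean :: 'a topology)"
  obtains C where "countable C" "C \<subseteq> {..<x}" "{..<x} = (\<Union>c\<in>C. {..c})"
proof (cases "\<exists>p<x. {p<..<x} = {}")
  case True
  then obtain p where p: "p < x" "{p<..<x} = {}"
    by blast
  have "{..<x} = {..p}"
  proof (intro set_eqI iffI)
    fix y assume "y \<in> {..<x}"
    then show "y \<in> {..p}"
      using p(2) by (metis atMost_iff empty_iff greaterThanLessThan_iff lessThan_iff not_le)
  qed (use p(1) in auto)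
  with p show thesis
    by (intro that[of "{p}"]) auto
next
  case False
  obtain D :: "'a set" where D: "countable D" "\<And>U. open U \<Longrightarrow> U \<noteq> {} \<Longrightarrow> D \<inter> U \<noteq> {}"
    using separable_space_countable_dense[OF assms] by blast
  have "\<exists>d\<in>D. d < x \<and> y \<le> d" if "y < x" for y
    using False that D(2)[of "{y<..<x}"] by fastforce
  then show thesis
    using D(1) by (intro that[of "D \<inter> {..<x}"]) fastforce+
qed

text \<open>If \<open>g\<close> had an immediate successor, it would belong to \<open>{g<..}\<close> but to no open ray
  \<open>{c<..}\<close> with \<open>g < c\<close>; this is why \<open>no_succ\<close> is assumed.\<close>

lemma greaterThan_eq_countable_Union_greaterThan:
  fixes g :: "'a::linorder_topology"
  assumes "separable_space (euclidean :: 'a topology)"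
    and no_succ: "\<And>z. g < z \<Longrightarrow> {g<..<z} \<noteq> {}"
  obtains C where "countable C" "C \<subseteq> {g<..}" "{g<..} = (\<Union>c\<in>C. {c<..})"
proof -
  obtain D :: "'a set" where D: "countable D" "\<And>U. open U \<Longrightarrow> U \<noteq> {} \<Longrightarrow> D \<inter> U \<noteq> {}"
    using separable_space_countable_dense[OF assms(1)] by blast
  have "\<exists>d\<in>D. g < d \<and> d < z" if "g < z" for z
    using no_succ[OF that] D(2)[of "{g<..<z}"] by fastforce
  then show thesis
    using D(1) by (intro that[of "D \<inter> {g<..}"]) fastforce+
qed

section \<open>One-sided continuity of the distribution function\<close>

context
  fixes \<mu> :: "'a::linorder_topology measure"
  assumes prob: "prob_space \<mu>" and borel: "sets \<mu> = sets borel"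
begin

interpretation prob_space \<mu>
  by (fact prob)

private lemma rays_measurable: "{..a} \<in> sets \<mu>" "{..<a} \<in> sets \<mu>" "{a<..} \<in> sets \<mu>" for a
  unfolding borel by (auto intro: borel_open borel_closed)

private lemma space_UNIV: "space \<mu> = UNIV"
  using sets_eq_imp_space_eq[OF borel] by simp

lemma cdf_le_left_cdf: "y < x \<Longrightarrow> lots_cdf \<mu> y \<le> lots_cdf_left \<mu> x"
  unfolding lots_cdf_def lots_cdf_left_def atMost_def[symmetric] lessThan_def[symmetric]
  by (intro finite_measure_mono rays_measurable) auto

lemma left_cdf_le_cdf: "lots_cdf_left \<mu> x \<le> lots_cdf \<mu> x"
  unfolding lots_cdf_def lots_cdf_left_def atMost_def[symmetric] lessThan_def[symmetric]
  by (intro finite_measure_mono rays_measurable) auto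

lemma cdf_mono: "x \<le> y \<Longrightarrow> lots_cdf \<mu> x \<le> lots_cdf \<mu> y"
  unfolding lots_cdf_def atMost_def[symmetric]
  by (intro finite_measure_mono rays_measurable) auto

lemma measure_greaterThan_eq_cdf: "measure \<mu> {x<..} = 1 - lots_cdf \<mu> x"
proof -
  have "{x<..} = space \<mu> - {..x}"
    by (auto simp: space_UNIV)
  then show ?thesis
    using prob_compl[OF rays_measurable(1)[of x]]
    by (simp add: lots_cdf_def atMost_def)
qed

lemma cdf_approximates_left_cdf:
  assumes sep: "separable_space (euclidean :: 'a topology)"
    and "0 \<le> r" "r < lots_cdf_left \<mu> x"
  shows "\<exists>y<x. r < lots_cdf \<mu> y"
proof -
  obtain C where C: "countable C" "C \<subseteq> {..<x}" "{..<x} = (\<Union>c\<in>C. {..c})"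
    using lessThan_eq_countable_Union_atMost[OF sep] by blast
  have "\<exists>S\<in>atMost ` C. r < measure \<mu> S"
  proof (rule measure_countable_chain_greater)
    show "subset.chain UNIV (atMost ` C)"
      by (auto simp: subset.chain_def)
    show "r < measure \<mu> (\<Union>(atMost ` C))"
      using assms(3) C(3) by (simp add: lots_cdf_left_def lessThan_def)
  qed (use C(1) \<open>0 \<le> r\<close> rays_measurable in auto)
  then show ?thesis
    using C(2) by (auto simp: lots_cdf_def atMost_def)
qed

text \<open>Applied to the complementary open rays, so that again a union of a chain has to be
  approximated from within.\<close>

lemma cdf_approximates_from_right:
  assumes sep: "separable_space (euclidean :: 'a topology)"
    and no_succ: "\<And>z. g < z \<Longrightarrow> {g<..<z} \<noteq> {}"
    and "r \<le> 1" "lots_cdf \<mu> g < r"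
  shows "\<exists>y>g. lots_cdf \<mu> y < r"
proof -
  obtain C where C: "countable C" "C \<subseteq> {g<..}" "{g<..} = (\<Union>c\<in>C. {c<..})"
    using greaterThan_eq_countable_Union_greaterThan[OF sep no_succ] by blast
  have "\<exists>S\<in>greaterThan ` C. 1 - r < measure \<mu> S"
  proof (rule measure_countable_chain_greater)
    show "subset.chain UNIV (greaterThan ` C)"
      by (auto simp: subset.chain_def)
    show "1 - r < measure \<mu> (\<Union>(greaterThan ` C))"
      using assms(4) C(3) measure_greaterThan_eq_cdf[of g] by simp
  qed (use C(1) \<open>r \<le> 1\<close> rays_measurable in auto)
  then show ?thesis
    using C(2) by (auto simp: measure_greaterThan_eq_cdf)
qed

text \<open>If \<open>g\<close> were outside the superlevel set, it would have no immediate successor, since that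
  successor would be a larger lower bound. So right continuity would give some \<open>y > g\<close> with
  \<open>F y < r\<close>, again a larger lower bound. This covers an empty superlevel set as well: \<open>g\<close> is then
  the maximum of the space, so it has no successor and no \<open>y\<close> above it.\<close>

lemma isGlb_cdf_superlevel_mem:
  assumes sep: "separable_space (euclidean :: 'a topology)"
    and glb: "isGlb UNIV {y. r \<le> lots_cdf \<mu> y} g" and "r \<le> 1"
  shows "r \<le> lots_cdf \<mu> g"
proof (rule ccontr)
  assume "\<not> ?thesis"
  then have less: "lots_cdf \<mu> g < r"
    by simp
  have lower: "g \<le> y" if "r \<le> lots_cdf \<mu> y" for y
    using glb that by (auto simp: isGlb_def greatestP_def isLb_def setge_def)
  have greatest: "z \<le> g" if "\<And>y. r \<le> lots_cdf \<mu> y \<Longrightarrow> z \<le> y" for z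
    using glb that by (auto simp: isGlb_def greatestP_def isLb_def setge_def setle_def)
  have "{g<..<z} \<noteq> {}" if "g < z" for z
  proof
    assume gap: "{g<..<z} = {}"
    have "z \<le> y" if "r \<le> lots_cdf \<mu> y" for y
    proof -
      have "g \<noteq> y"
        using less that by auto
      with lower[OF that] have "g < y"
        by simp
      moreover have "y \<notin> {g<..<z}"
        using gap by blast
      ultimately show ?thesis
        by simp
    qed
    then show False
      using greatest[of z] \<open>g < z\<close> by auto
  qed
  then obtain y where y: "g < y" "lots_cdf \<mu> y < r"
    using cdf_approximates_from_right[OF sep _ \<open>r \<le> 1\<close> less] by blast
  have "y \<le> w" if "r \<le> lots_cdf \<mu> w" for w
    using that y(2) cdf_mono[of w y] by fastforce
  then show False
    using greatest[of y] y(1) by auto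
qed

end

section \<open>The pseudo-inverse\<close>

lemma pseudo_inverse_eq_Some_iff:
  "pseudo_inverse \<mu> r = Some g \<longleftrightarrow> r \<in> {0..1} \<and> isGlb UNIV {y. r \<le> lots_cdf \<mu> y} g"
proof -
  have "(THE g. isGlb UNIV {y. r \<le> lots_cdf \<mu> y} g) = g"
    if "isGlb UNIV {y. r \<le> lots_cdf \<mu> y} g" for g
    using that by (rule the_equality) (rule isGlb_unique[OF _ that])
  then show ?thesis
    unfolding pseudo_inverse_def by auto
qed

theorem proposition6p6:
  fixes \<mu> :: "'a::linorder_topology measure" and x :: 'a and r :: real
  defines "F \<equiv> lots_cdf \<mu>" and "F' \<equiv> lots_cdf_left \<mu>" and "G \<equiv> pseudo_inverse \<mu>"
  assumes "separable_space (euclidean :: 'a topology)"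
    and "prob_space \<mu>" and "sets \<mu> = sets borel"
    and "r \<in> {0..1}"
  shows "(r \<in> dom G \<longrightarrow> (F x < r \<longleftrightarrow> the (G r) > x)) \<and>
         (r \<in> dom G \<longrightarrow> F' x < r \<longrightarrow> x \<le> the (G r)) \<and>
         (F' x < r \<and> r \<le> F x \<longrightarrow> r \<in> dom G \<and> the (G r) = x) \<and>
         (r \<in> dom G \<longrightarrow> r < F' x \<longrightarrow> the (G r) < x) \<and>
         (r \<in> dom G \<longrightarrow> r = F' x \<longrightarrow> the (G r) \<le> x)"
proof -
  note \<mu> = \<open>prob_space \<mu>\<close> \<open>sets \<mu> = sets borel\<close>
  have r: "0 \<le> r" "r \<le> 1"
    using \<open>r \<in> {0..1}\<close> by auto
  have glb: "isGlb UNIV {y. r \<le> F y} (the (G r))" if dom: "r \<in> dom G"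
  proof -
    obtain g where g: "G r = Some g"
      using dom by blast
    then have "isGlb UNIV {y. r \<le> F y} g"
      by (simp add: G_def F_def pseudo_inverse_eq_Some_iff)
    with g show ?thesis
      by simp
  qed
  have lower: "the (G r) \<le> y" if "r \<in> dom G" "r \<le> F y" for y
    using glb[OF that(1)] that(2) by (auto simp: isGlb_def greatestP_def isLb_def setge_def)
  have greatest: "z \<le> the (G r)" if "r \<in> dom G" "\<And>y. r \<le> F y \<Longrightarrow> z \<le> y" for z
    using glb[OF that(1)] that(2)
    by (auto simp: isGlb_def greatestP_def isLb_def setge_def setle_def)
  have attained: "r \<le> F (the (G r))" if "r \<in> dom G"
    using isGlb_cdf_superlevel_mem[OF \<mu> assms(4)] glb[OF that] r(2) by (simp add: F_def)
  have x_lower: "x \<le> y" if "F' x < r" "r \<le> F y" for y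
    using that cdf_le_left_cdf[OF \<mu>, of y x] by (cases "y < x") (auto simp: F_def F'_def)
  have 1: "F x < r \<longleftrightarrow> the (G r) > x" if "r \<in> dom G"
  proof
    assume "F x < r"
    then have "F x < F (the (G r))"
      using attained[OF that] by simp
    then show "the (G r) > x"
      using cdf_mono[OF \<mu>, of "the (G r)" x] by (cases "the (G r) \<le> x") (auto simp: F_def)
  next
    assume "the (G r) > x"
    then show "F x < r"
      using lower[OF that, of x] by (cases "r \<le> F x") auto
  qed
  have 2: "x \<le> the (G r)" if "r \<in> dom G" "F' x < r"
    using greatest[OF that(1)] x_lower[OF that(2)] by blast
  have 3: "G r = Some x" if "F' x < r" "r \<le> F x"
  proof -
    have "isGlb UNIV {y. r \<le> F y} x"
      using that x_lower by (auto simp: isGlb_def greatestP_def isLb_def setge_def setle_def)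
    then show ?thesis
      using \<open>r \<in> {0..1}\<close> by (simp add: G_def F_def pseudo_inverse_eq_Some_iff)
  qed
  have 4: "the (G r) < x" if dom: "r \<in> dom G" and less: "r < F' x"
  proof -
    obtain y where "y < x" "r < F y"
      using cdf_approximates_left_cdf[OF \<mu> assms(4) r(1)] less by (auto simp: F_def F'_def)
    then show ?thesis
      using lower[OF dom, of y] by simp
  qed
  have 5: "the (G r) \<le> x" if "r \<in> dom G" "r = F' x"
    using lower[OF that(1), of x] that(2) left_cdf_le_cdf[OF \<mu>, of x] by (simp add: F_def F'_def)
  show ?thesis
    using 1 2 3 4 5 by (intro conjI impI) (simp_all add: domIff)
qed

end
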